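(* Let $R$ be a ring, and let $a,b,c\in R$ satisfy $aba=aca$. Then $ac$ has a generalized Hirano inverse if and only if $ba$ has a generalized Hirano inverse. In this case, $(ba)^{h}=b\big((ac)^{h}\big)^2a$.
   Context: Rings are associative with identity; $U(R)$ is the group of units of $R$. For $a\in R$: $comm(a)=\{x\in R : xa=ax\}$ and $comm^2(a)=\{x\in R : xy=yx \text{ for all } y\in comm(a)\}$. $R^{qnil}=\{a\in R : 1+ax\in U(R)\text{ for every }x\in comm(a)\}$. An element $a\in R$ has a generalized Hirano inverse if there exists $b\in R$ such that $b=bab$, $b\in comm^2(a)$ and $a^2-ab\in R^{qnil}$. Such $b$ is unique if it exists and is denoted $a^h$. *)

theory Defs
  imports Main
begin

text \<open>
  The sort \<open>{ring, monoid_mult}\<close> is that of associative, not necessarily commutative rings with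
  identity. Unlike \<open>ring_1\<close> it does not demand \<open>0 \<noteq> 1\<close>, so the zero ring is included.
\<close>

text \<open>Two-sided invertibility is spelled out because \<open>u dvd 1\<close> is one-sided in a
  noncommutative ring.\<close>

definition ring_units :: "'a::{ring, monoid_mult} set" where
  "ring_units = {u. \<exists>v. u * v = 1 \<and> v * u = 1}"

definition comm :: "'a::{ring, monoid_mult} \<Rightarrow> 'a set" where
  "comm a = {x. x * a = a * x}"

definition comm2 :: "'a::{ring, monoid_mult} \<Rightarrow> 'a set" where
  "comm2 a = {x. \<forall>y\<in>comm a. x * y = y * x}"

definition qnil :: "'a::{ring, monoid_mult} set" where
  "qnil = {a. \<forall>x\<in>comm a. 1 + a * x \<in> ring_units}"

definition is_gen_hirano_inverse :: "'a::{ring, monoid_mult} \<Rightarrow> 'a \<Rightarrow> bool" where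
  "is_gen_hirano_inverse a b \<longleftrightarrow> b = b * a * b \<and> b \<in> comm2 a \<and> a ^ 2 - a * b \<in> qnil"

definition has_gen_hirano_inverse :: "'a::{ring, monoid_mult} \<Rightarrow> bool" where
  "has_gen_hirano_inverse a \<longleftrightarrow> (\<exists>b. is_gen_hirano_inverse a b)"

text \<open>Meaningful only if \<open>has_gen_hirano_inverse a\<close>; the description is then proper by
  \<open>is_gen_hirano_inverse_unique\<close> below.\<close>

definition gen_hirano_inverse :: "'a::{ring, monoid_mult} \<Rightarrow> 'a" where
  "gen_hirano_inverse a = (THE b. is_gen_hirano_inverse a b)"

lemma is_gen_hirano_inverse_absorb:
  fixes a b c :: "'a::{ring, monoid_mult}"
  assumes b: "is_gen_hirano_inverse a b" and c: "is_gen_hirano_inverse a c"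
  shows "a * b = a * b * (a * c)"
proof -
  have bab: "b * a * b = b" and cac: "c * a * c = c"
    and b2: "b \<in> comm2 a" and c2: "c \<in> comm2 a" and q: "a ^ 2 - a * c \<in> qnil"
    using b c unfolding is_gen_hirano_inverse_def by auto
  have ba: "b * a = a * b" and ca: "c * a = a * c"
    using b2 c2 unfolding comm2_def comm_def by auto
  have bc: "b * c = c * b"
    using b2 ca unfolding comm2_def comm_def by auto
  define e where "e = a * b"
  define f where "f = a * c"
  have ee: "e * e = e" unfolding e_def using bab by (metis mult.assoc)
  have ff: "f * f = f" unfolding f_def using cac by (metis mult.assoc)
  have ea: "e * a = a * e" and eb: "e * b = b * e" unfolding e_def by (metis ba mult.assoc)+
  have fa: "f * a = a * f" unfolding f_def by (metis ca mult.assoc)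
  have fb: "f * b = b * f" unfolding f_def by (metis ba bc mult.assoc)
  have fe: "f * e = e * f" unfolding e_def by (metis fa fb mult.assoc)
  define x where "x = - (b * b * (1 - f))"
  have xa: "x * a = a * x"
    unfolding x_def by (simp add: algebra_simps) (metis ba fa mult.assoc)
  have xf: "x * f = f * x"
    unfolding x_def by (simp add: algebra_simps) (metis fb ff mult.assoc)
  have "x * (a ^ 2 - f) = (a ^ 2 - f) * x"
    unfolding power2_eq_square right_diff_distrib left_diff_distrib
    by (metis xa xf mult.assoc)
  then have "1 + (a ^ 2 - f) * x \<in> ring_units"
    using q unfolding qnil_def comm_def f_def by auto
  moreover have "(a ^ 2 - f) * x = - (e * (1 - f))"
  proof -
    have aabb: "a * a * (b * b) = e" using ee unfolding e_def by (metis ba mult.assoc)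
    have "f * x = - (b * b * (f * (1 - f)))"
      unfolding x_def by (metis fb mult.assoc mult_minus_right)
    then have "f * x = 0" using ff by (simp add: right_diff_distrib)
    moreover have "a ^ 2 * x = - (e * (1 - f))"
      unfolding x_def power2_eq_square using aabb by (metis mult.assoc mult_minus_right)
    ultimately show ?thesis by (simp add: left_diff_distrib)
  qed
  ultimately obtain v where v: "(1 - e * (1 - f)) * v = 1"
    unfolding ring_units_def by auto
  have gg: "e * (1 - f) * (1 - e * (1 - f)) = 0"
  proof -
    have "e * (e * f) = e * f" "f * (e * f) = e * f" "e * f * f = e * f" "e * (f * (e * f)) = e * f"
      "e * (f * e) = e * f" by (metis ee ff fe mult.assoc)+
    then show ?thesis by (simp add: algebra_simps ee ff fe)
  qed
  have "e * (1 - f) = e * (1 - f) * ((1 - e * (1 - f)) * v)" using v by simp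
  also have "\<dots> = 0" using gg by (metis mult.assoc mult_zero_left)
  finally show ?thesis unfolding e_def f_def by (simp add: right_diff_distrib)
qed

lemma is_gen_hirano_inverse_unique:
  fixes a b c :: "'a::{ring, monoid_mult}"
  assumes b: "is_gen_hirano_inverse a b" and c: "is_gen_hirano_inverse a c"
  shows "b = c"
proof -
  have bab: "b * a * b = b" and cac: "c * a * c = c"
    and b2: "b \<in> comm2 a" and c2: "c \<in> comm2 a"
    using b c unfolding is_gen_hirano_inverse_def by auto
  have ba: "b * a = a * b" and ca: "c * a = a * c"
    using b2 c2 unfolding comm2_def comm_def by auto
  have bc: "b * c = c * b"
    using b2 ca unfolding comm2_def comm_def by auto
  have "a * b * (a * c) = a * c * (a * b)" by (metis ba ca bc mult.assoc)
  then have "a * b = a * c"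
    using is_gen_hirano_inverse_absorb[OF b c] is_gen_hirano_inverse_absorb[OF c b] by simp
  then show ?thesis by (metis ba bab bc ca cac mult.assoc)
qed

end

theory Submission
  imports Defs
begin

text \<open>
  Write \<open>p = ac\<close>, \<open>q = ba\<close>, so that \<open>pa = aq\<close>. Every \<open>y\<close> commuting with \<open>q\<close> yields the element
  \<open>a y b a c\<close> commuting with \<open>p\<close>, through which double commutants and quasinilpotency pass from \<open>p\<close>
  to \<open>q\<close>. If \<open>h\<close> is the inverse of \<open>p\<close>, then \<open>k = b h\<^sup>2 a\<close> satisfies \<open>q\<^sup>2 - q k = b (p - h) a\<close>, and
  quasinilpotency transfers to it because the triple \<open>(p - h) a, b, c\<close> satisfies the hypothesis on
  \<open>a, b, c\<close> again. The converse needs no dual argument: the implication just described, applied to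
  suitable triples, leads from \<open>ba\<close> to \<open>ab\<close>, to \<open>ca\<close>, and to \<open>ac\<close>.
\<close>

text \<open>Jacobson's lemma: if \<open>w\<close> inverts \<open>1 + u * v\<close>, then
  \<open>1 - v * w * u\<close> inverts \<open>1 + v * u\<close>.\<close>

lemma ring_units_one_plus_swap:
  fixes u v :: "'a::{ring, monoid_mult}"
  assumes "1 + u * v \<in> ring_units"
  shows "1 + v * u \<in> ring_units"
proof -
  obtain w where r: "(1 + u * v) * w = 1" and l: "w * (1 + u * v) = 1"
    using assms unfolding ring_units_def by auto
  have "(1 + v * u) * (1 - v * w * u) = 1 + v * (1 - (1 + u * v) * w) * u"
    by (simp add: algebra_simps)
  moreover have "(1 - v * w * u) * (1 + v * u) = 1 + v * (1 - w * (1 + u * v)) * u"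
    by (simp add: algebra_simps)
  ultimately show ?thesis
    unfolding ring_units_def using r l by auto
qed

text \<open>\<open>1 + z\<close> divides \<open>1 + z * z * z\<close> from either side with cofactor
  \<open>1 - z + z * z\<close>, so it has a left and a right inverse, and these must agree.\<close>

lemma ring_units_one_plus_cube:
  fixes z :: "'a::{ring, monoid_mult}"
  assumes "1 + z * z * z \<in> ring_units"
  shows "1 + z \<in> ring_units"
proof -
  obtain w where r: "(1 + z * z * z) * w = 1" and l: "w * (1 + z * z * z) = 1"
    using assms unfolding ring_units_def by auto
  define t where "t = 1 - z + z * z"
  have zt: "(1 + z) * t = 1 + z * z * z" and tz: "t * (1 + z) = 1 + z * z * z"
    unfolding t_def by (simp_all add: algebra_simps)
  have right: "(1 + z) * (t * w) = 1"
    using r zt by (metis mult.assoc)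
  have left: "w * t * (1 + z) = 1"
    using l tz by (metis mult.assoc)
  have "w * t = w * t * ((1 + z) * (t * w))"
    using right by simp
  also have "\<dots> = t * w"
    using left by (simp add: mult.assoc[symmetric])
  finally have "w * t = t * w" .
  then show ?thesis
    unfolding ring_units_def using left right by auto
qed

text \<open>Trading \<open>a * c * a\<close> for \<open>a * b * a\<close> exposes a factor
  \<open>b * a\<close>, which slides past \<open>y\<close> and is traded back on the other
  side.\<close>

lemma comm_transfer:
  fixes a b c y :: "'a::{ring, monoid_mult}"
  assumes aba: "a * b * a = a * c * a" and y: "y \<in> comm (b * a)"
  shows "a * y * b * a * c \<in> comm (a * c)"
proof -
  have yq: "y * (b * a) = b * a * y"
    using y unfolding comm_def by simp
  have "a * c * (a * y * b * a * c) = a * b * a * y * b * a * c"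
    by (simp add: aba mult.assoc[symmetric])
  also have "\<dots> = a * (b * a * y) * (b * a * c)"
    by (simp add: mult.assoc)
  also have "\<dots> = a * y * b * (a * b * a) * c"
    unfolding yq[symmetric] by (simp add: mult.assoc)
  also have "\<dots> = a * y * b * a * c * (a * c)"
    unfolding aba by (simp add: mult.assoc)
  finally show ?thesis
    unfolding comm_def by simp
qed

lemma qnil_transfer:
  fixes a b c :: "'a::{ring, monoid_mult}"
  assumes aba: "a * b * a = a * c * a" and ac: "a * c \<in> qnil"
  shows "b * a \<in> qnil"
  unfolding qnil_def
proof (intro CollectI ballI)
  fix y
  assume "y \<in> comm (b * a)"
  then have yq: "y * (b * a) = b * a * y"
    unfolding comm_def by simp
  \<comment> \<open>The cube of \<open>y\<close> is used because \<open>v * u\<close> becomes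
    \<open>(q * y)\<close> cubed, while \<open>u * v\<close> is \<open>a * c\<close> times an
    element of its commutant. Quasinilpotency of \<open>a * c\<close> makes \<open>1 + u * v\<close>
    a unit; swapping the factors and removing the cube gives \<open>1 + q * y\<close>.\<close>
  define u where "u = a * (y * y * y)"
  define v where "v = b * a * b * a * c"
  define q where "q = b * a"
  have yq': "y * q = q * y" using yq unfolding q_def .
  have yq'': "y * (q * z) = q * (y * z)" for z
    using yq' by (metis mult.assoc)
  have y3: "y * y * y * q = q * (y * y * y)"
    by (simp add: yq' yq'' mult.assoc)
  then have "a * (y * y * y) * b * a * c \<in> comm (a * c)"
    by (intro comm_transfer[OF aba]) (simp add: comm_def q_def)
  then have "1 + a * c * (a * (y * y * y) * b * a * c) \<in> ring_units"
    using ac unfolding qnil_def by blast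
  moreover have "a * c * (a * (y * y * y) * b * a * c) = u * v"
  proof -
    have "a * c * (a * (y * y * y) * b * a * c) = a * b * a * (y * y * y) * b * a * c"
      by (simp add: aba mult.assoc[symmetric])
    also have "\<dots> = a * (q * (y * y * y)) * q * c"
      by (simp add: q_def mult.assoc)
    also have "\<dots> = u * v"
      unfolding y3[symmetric] by (simp add: u_def v_def q_def mult.assoc)
    finally show ?thesis .
  qed
  ultimately have "1 + v * u \<in> ring_units"
    by (metis ring_units_one_plus_swap)
  moreover have "v * u = (q * y) * (q * y) * (q * y)"
  proof -
    have "v * u = b * a * b * (a * c * a) * (y * y * y)"
      by (simp add: u_def v_def mult.assoc)
    also have "\<dots> = q * q * q * (y * y * y)"
      unfolding aba[symmetric] by (simp add: q_def mult.assoc)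
    also have "\<dots> = (q * y) * (q * y) * (q * y)"
      by (simp add: yq' yq'' mult.assoc)
    finally show ?thesis .
  qed
  ultimately show "1 + b * a * y \<in> ring_units"
    unfolding q_def by (metis ring_units_one_plus_cube)
qed

lemma is_gen_hirano_inverse_transfer:
  fixes a b c h :: "'a::{ring, monoid_mult}"
  assumes aba: "a * b * a = a * c * a" and inv: "is_gen_hirano_inverse (a * c) h"
  shows "is_gen_hirano_inverse (b * a) (b * h ^ 2 * a)"
proof -
  define p where "p = a * c"
  define q where "q = b * a"
  define k where "k = b * (h * h) * a"
  have hph: "h * p * h = h" and h2: "h \<in> comm2 p" and qn: "p ^ 2 - p * h \<in> qnil"
    using inv unfolding is_gen_hirano_inverse_def p_def by auto
  have hp: "h * p = p * h"
    using h2 unfolding comm2_def comm_def by auto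
  have hp': "h * (p * z) = p * (h * z)" for z
    using hp by (metis mult.assoc)
  have phh: "p * (h * h) = h"
    using hph by (simp add: hp hp' mult.assoc)
  have phh': "p * (h * (h * z)) = h * z" for z
    using phh by (metis mult.assoc)
  have pa: "p * a = a * q"
    unfolding p_def q_def by (metis aba mult.assoc)
  \<comment> \<open>Left multiplication by \<open>a * b\<close> agrees with that by \<open>p\<close>
    on the right ideal generated by \<open>p\<close>, and \<open>h = p * (h * h)\<close> lies in
    that ideal.\<close>
  have abp: "a * b * p = p * p"
    unfolding p_def by (metis aba mult.assoc)
  have abh: "a * b * h = p * h"
    using abp phh by (metis mult.assoc)
  have abhh: "a * b * (h * h) = h"
    using abh phh by (metis mult.assoc)
  have qk: "q * k = b * h * a"
    unfolding q_def k_def using abhh by (metis mult.assoc)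
  have "k * q = b * (h * h) * (p * a)"
    unfolding k_def pa by (simp add: mult.assoc)
  also have "\<dots> = b * h * a"
    by (simp add: phh' hp' mult.assoc)
  finally have kq: "k * q = b * h * a" .
  have kqk: "k = k * q * k"
  proof -
    have "k * q * k = b * h * (a * b * (h * h)) * a"
      unfolding kq by (simp add: k_def mult.assoc)
    then show ?thesis
      unfolding abhh k_def by (simp add: mult.assoc)
  qed
  have k2: "k \<in> comm2 q"
    unfolding comm2_def
  proof (intro CollectI ballI)
    fix y
    assume y: "y \<in> comm q"
    then have yq: "y * q = q * y"
      unfolding comm_def by simp
    define x where "x = a * y * b * a * c"
    \<comment> \<open>The fourth power leaves room for \<open>p * p\<close> on either side:
      \<open>g * (p * p) = h * h = p * p * g\<close>. The left form turns
      \<open>p * p * a * y\<close> into \<open>x * a\<close>, then \<open>x\<close> passes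
      \<open>g\<close>, and \<open>b * x\<close> releases \<open>y\<close> on the left.\<close>
    define g where "g = h * h * (h * h)"
    have "x \<in> comm p"
      using comm_transfer[OF aba, of y] y unfolding x_def p_def q_def by simp
    then have hx: "h * x = x * h"
      using h2 unfolding comm2_def by blast
    then have gx: "g * x = x * g"
      unfolding g_def by (metis mult.assoc)
    have gp: "g * (p * p) = h * h" and pg: "p * p * g = h * h"
      by (simp_all add: g_def phh phh' hp hp' mult.assoc)
    have "p * p * a * y = a * (q * (q * y))"
      using pa by (metis mult.assoc)
    also have "\<dots> = a * (y * (q * q))"
      using yq by (metis mult.assoc)
    also have "\<dots> = a * y * b * (a * b * a)"
      by (simp add: q_def mult.assoc)
    also have "\<dots> = x * a"
      unfolding aba x_def by (simp add: mult.assoc)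
    finally have ppay: "p * p * a * y = x * a" .
    have bx: "b * x = y * b * (p * p)"
    proof -
      have "b * x = (q * y) * b * p"
        unfolding x_def q_def p_def by (simp add: mult.assoc)
      also have "\<dots> = y * b * (a * b * p)"
        unfolding yq[symmetric] by (simp add: q_def mult.assoc)
      finally show ?thesis
        unfolding abp .
    qed
    have "k * y = b * g * (p * p * a * y)"
      unfolding k_def gp[symmetric] by (simp add: mult.assoc)
    also have "\<dots> = b * x * g * a"
      unfolding ppay using gx by (metis mult.assoc)
    also have "\<dots> = y * k"
      unfolding bx k_def pg[symmetric] by (simp add: mult.assoc)
    finally show "k * y = y * k" .
  qed
  have "q ^ 2 - q * k \<in> qnil"
  proof -
    \<comment> \<open>With \<open>w * a\<close> in place of \<open>a\<close>, the two products are
      exactly the elements to compare: \<open>w * a * c\<close> is \<open>p ^ 2 - p * h\<close> and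
      \<open>b * (w * a)\<close> is \<open>q ^ 2 - q * k\<close>.\<close>
    define w where "w = p - h"
    have abw: "a * b * w = p * w"
      unfolding w_def right_diff_distrib abp abh ..
    have "(w * a) * b * (w * a) = w * (a * b * w) * a"
      by (simp add: mult.assoc)
    also have "\<dots> = (w * a) * c * (w * a)"
      unfolding abw by (simp add: p_def mult.assoc)
    finally have waba: "(w * a) * b * (w * a) = (w * a) * c * (w * a)" .
    have "(w * a) * c = p ^ 2 - p * h"
      using hp by (simp add: mult.assoc p_def[symmetric] w_def left_diff_distrib power2_eq_square)
    then have "b * (w * a) \<in> qnil"
      using qnil_transfer[OF waba] qn by simp
    moreover have "q ^ 2 - q * k = b * (w * a)"
    proof -
      have "q * q = b * (p * a)"
        unfolding pa by (simp add: q_def mult.assoc)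
      then show ?thesis
        unfolding qk w_def power2_eq_square by (simp add: algebra_simps)
    qed
    ultimately show ?thesis by simp
  qed
  then show ?thesis
    using kqk k2 unfolding is_gen_hirano_inverse_def q_def k_def power2_eq_square by blast
qed

lemma has_gen_hirano_inverse_transfer:
  fixes a b c :: "'a::{ring, monoid_mult}"
  assumes "a * b * a = a * c * a" and "has_gen_hirano_inverse (a * c)"
  shows "has_gen_hirano_inverse (b * a)"
  using assms is_gen_hirano_inverse_transfer unfolding has_gen_hirano_inverse_def by blast

lemma gen_hirano_inverse_eqI:
  fixes a b :: "'a::{ring, monoid_mult}"
  assumes "is_gen_hirano_inverse a b"
  shows "gen_hirano_inverse a = b"
  unfolding gen_hirano_inverse_def
  using assms by (rule the_equality) (rule is_gen_hirano_inverse_unique[OF _ assms])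

theorem theorem4p1:
  fixes a b c :: "'a::{ring, monoid_mult}"
  assumes "a * b * a = a * c * a"
  shows "(has_gen_hirano_inverse (a * c) \<longleftrightarrow> has_gen_hirano_inverse (b * a)) \<and>
    (has_gen_hirano_inverse (a * c) \<longrightarrow>
      gen_hirano_inverse (b * a) = b * (gen_hirano_inverse (a * c)) ^ 2 * a)"
proof (intro conjI iffI impI)
  assume "has_gen_hirano_inverse (a * c)"
  then show "has_gen_hirano_inverse (b * a)"
    by (rule has_gen_hirano_inverse_transfer[OF assms])
next
  assume "has_gen_hirano_inverse (b * a)"
  \<comment> \<open>For a triple whose last two entries coincide the hypothesis is trivial, so the
    transfer just swaps the two factors. Between two such swaps it is applied with \<open>b\<close>
    and \<open>c\<close> exchanged.\<close>
  then have "has_gen_hirano_inverse (a * b)"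
    by (rule has_gen_hirano_inverse_transfer[OF refl])
  then have "has_gen_hirano_inverse (c * a)"
    by (rule has_gen_hirano_inverse_transfer[OF assms[symmetric]])
  then show "has_gen_hirano_inverse (a * c)"
    by (rule has_gen_hirano_inverse_transfer[OF refl])
next
  assume "has_gen_hirano_inverse (a * c)"
  then obtain h where h: "is_gen_hirano_inverse (a * c) h"
    unfolding has_gen_hirano_inverse_def by blast
  show "gen_hirano_inverse (b * a) = b * (gen_hirano_inverse (a * c)) ^ 2 * a"
    unfolding gen_hirano_inverse_eqI[OF h]
    by (rule gen_hirano_inverse_eqI[OF is_gen_hirano_inverse_transfer[OF assms h]])
qed

end
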